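(* Every $(p,m,1)$ signed graph $S$ on a double star whose single negative edge is a pendant edge is additively graceful.
   Context: A signed graph $S$ is a finite simple graph on $p$ vertices in which $m$ edges are specified as positive and the remaining $n$ edges are specified as negative; it is then called a $(p,m,n)$ signed graph, with sets of positive and negative edges $E^+(S)$ and $E^-(S)$. "A signed graph on $G$" means a signed graph whose underlying graph (ignoring signs) is $G$. Given two stars $K_{1,r}$ and $K_{1,s}$, each with a chosen central vertex, a double star is the graph obtained from their disjoint union by joining the two central vertices by an edge. A pendant edge is the unique edge incident to a vertex of degree 1. An additively graceful labeling of a $(p,m,n)$ signed graph $S=(V,E)$ is an injective map $f:V\to\{0,1,\dots,m+\lceil\frac{n+1}{2}\rceil\}$ such that, with $f^*(uv)=f(u)+f(v)$ for $uv\in E^-(S)$ and $f^*(uv)=|f(u)-f(v)|$ for $uv\in E^+(S)$, one has $\{f^*(uv):uv\in E^-(S)\}=\{1,2,\dots,n\}$ and $\{f^*(uv):uv\in E^+(S)\}=\{1,2,\dots,m\}$. $S$ is additively graceful if it admits such a labeling. *)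

theory Defs imports Complex_Main begin

text \<open>Graphs are pairs of a vertex set and an edge set; an edge is a two-element set of vertices.\<close>

type_synonym 'a graph = "'a set \<times> 'a set set"

definition simple_graph :: "'a graph \<Rightarrow> bool" where
  "simple_graph G \<longleftrightarrow> (\<forall>e \<in> snd G. e \<subseteq> fst G \<and> card e = 2)"

definition degree :: "'a graph \<Rightarrow> 'a \<Rightarrow> nat" where
  "degree G v = card {e \<in> snd G. v \<in> e}"

definition pendant_edge :: "'a graph \<Rightarrow> 'a set \<Rightarrow> bool" where
  "pendant_edge G e \<longleftrightarrow> e \<in> snd G \<and> (\<exists>v \<in> fst G. degree G v = 1 \<and> v \<in> e)"

text \<open>\<open>is_star G c r\<close>: \<open>G\<close> is a copy of the star \<open>K\<^bsub>1,r\<^esub>\<close> with chosen central vertex \<open>c\<close>.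
  For \<open>r = 0\<close> this is the one-vertex graph.\<close>

definition is_star :: "'a graph \<Rightarrow> 'a \<Rightarrow> nat \<Rightarrow> bool" where
  "is_star G c r \<longleftrightarrow>
     finite (fst G) \<and> c \<in> fst G \<and> card (fst G - {c}) = r \<and>
     snd G = {{c, x} | x. x \<in> fst G - {c}}"

definition double_star :: "'a graph \<Rightarrow> bool" where
  "double_star G \<longleftrightarrow>
     (\<exists>V1 E1 c1 r V2 E2 c2 s.
        is_star (V1, E1) c1 r \<and> is_star (V2, E2) c2 s \<and> V1 \<inter> V2 = {} \<and>
        G = (V1 \<union> V2, E1 \<union> E2 \<union> {{c1, c2}}))"

record 'a sgraph =
  verts :: "'a set"
  pos_edges :: "'a set set"
  neg_edges :: "'a set set"

definition underlying :: "'a sgraph \<Rightarrow> 'a graph" where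
  "underlying S = (verts S, pos_edges S \<union> neg_edges S)"

definition signed_graph :: "'a sgraph \<Rightarrow> nat \<Rightarrow> nat \<Rightarrow> nat \<Rightarrow> bool" where
  "signed_graph S p m n \<longleftrightarrow>
     finite (verts S) \<and> simple_graph (underlying S) \<and> pos_edges S \<inter> neg_edges S = {} \<and>
     card (verts S) = p \<and> card (pos_edges S) = m \<and> card (neg_edges S) = n"

definition additively_graceful_labeling :: "'a sgraph \<Rightarrow> ('a \<Rightarrow> nat) \<Rightarrow> bool" where
  "additively_graceful_labeling S f \<longleftrightarrow>
     (let m = card (pos_edges S); n = card (neg_edges S) in
        inj_on f (verts S) \<and>
        f ` verts S \<subseteq> {0..m + nat \<lceil>(real n + 1) / 2\<rceil>} \<and>
        {f u + f v | u v. {u, v} \<in> neg_edges S} = {1..n} \<and>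
        {\<bar>int (f u) - int (f v)\<bar> | u v. {u, v} \<in> pos_edges S} = {1..int m})"

definition additively_graceful :: "'a sgraph \<Rightarrow> bool" where
  "additively_graceful S \<longleftrightarrow> (\<exists>f. additively_graceful_labeling S f)"

end

theory Submission imports Defs begin

text \<open>
  Why the theorem holds. A \<open>(p, m, 1)\<close> signed graph on a tree has \<open>m + 2\<close> vertices, and its labels
  are taken from \<open>{0..m + 1}\<close>, so every label must be used and the ends of the negative edge
  must carry \<open>0\<close> and \<open>1\<close>. Give \<open>0\<close> to the leaf \<open>x\<close> of the negative edge and \<open>1\<close> to its other
  end \<open>c\<close>. What remains is to label the tree without \<open>x\<close> gracefully by \<open>1, \<dots>, m + 1\<close>, starting
  from \<open>c\<close>. Let \<open>A\<close> be the set of neighbours of \<open>c\<close> other than \<open>x\<close>, let \<open>d \<in> A\<close> be the second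
  centre, and let \<open>B\<close> be the set of leaves at \<open>d\<close>, with \<open>b\<close> elements. The smallest labels
  \<open>2, \<dots>, b + 1\<close> go to \<open>B\<close>, the next one \<open>b + 2\<close> to \<open>d\<close>, and the largest ones to the rest of
  \<open>A\<close>. The edges at \<open>c\<close> then produce exactly the differences \<open>b + 1, \<dots>, m\<close>, and the edges from
  \<open>d\<close> to \<open>B\<close> produce exactly \<open>1, \<dots>, b\<close>.

  The negative edge can also be the edge joining the two centres, when one of the stars is a single
  vertex. The graph is then a star centred at \<open>c\<close>, and the same labeling works with \<open>B\<close> empty.
  Lemma \<open>double_star_pendant_edge_decomposition\<close> brings all positions of the negative edge into
  this form, and lemma \<open>additively_graceful_broom\<close> carries out the labeling.
\<close>

section \<open>The labeling\<close>

text \<open>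
  The labeling prescribes only which block of labels goes to a set of leaves, except that the
  second centre must receive the smallest label of its block.
\<close>

lemma ex_bij_betw_interval_fixing_min:
  fixes k :: nat
  assumes "finite A"
  obtains h where "bij_betw h A {k..<k + card A}" and "d \<in> A \<Longrightarrow> h d = k"
proof (cases "d \<in> A")
  case True
  have "card (A - {d}) = card {Suc k..<k + card A}"
    using True by simp
  then obtain h where h: "bij_betw h (A - {d}) {Suc k..<k + card A}"
    using finite_same_card_bij[of "A - {d}" "{Suc k..<k + card A}"] assms by blast
  then have "bij_betw (h(d := k)) (A - {d}) {Suc k..<k + card A}"
    by (rule bij_betw_cong[THEN iffD1, rotated]) auto
  then have "bij_betw (h(d := k)) (A - {d} \<union> {d}) ({Suc k..<k + card A} \<union> {k})"
    by (rule bij_betw_combine) (auto simp: bij_betw_def)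
  moreover have "A - {d} \<union> {d} = A"
    using True by blast
  moreover have "{Suc k..<k + card A} \<union> {k} = {k..<k + card A}"
    using True assms card_gt_0_iff[of A] by auto
  ultimately have "bij_betw (h(d := k)) A {k..<k + card A}"
    by simp
  then show ?thesis using that by simp
next
  case False
  obtain h where "bij_betw h A {k..<k + card A}"
    using finite_same_card_bij[of A "{k..<k + card A}"] assms by auto
  with False that show ?thesis by blast
qed

text \<open>
  An edge \<open>{u, v}\<close> of a star does not tell which of \<open>u\<close> and \<open>v\<close> is the centre, but the absolute
  difference of their labels is symmetric, so it can be computed from the labels of the leaves alone.
\<close>

lemma edge_differences_two_stars:
  "{\<bar>int (f u) - int (f v)\<bar> | u v. {u, v} \<in> (\<lambda>y. {c, y}) ` A \<union> (\<lambda>y. {d, y}) ` B} =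
     (\<lambda>k. \<bar>int (f c) - int k\<bar>) ` f ` A \<union> (\<lambda>k. \<bar>int (f d) - int k\<bar>) ` f ` B"
  (is "?L = ?R")
proof
  show "?L \<subseteq> ?R"
  proof
    fix t assume "t \<in> ?L"
    then obtain u v where t: "t = \<bar>int (f u) - int (f v)\<bar>"
      and uv: "{u, v} \<in> (\<lambda>y. {c, y}) ` A \<union> (\<lambda>y. {d, y}) ` B" by blast
    from uv consider y where "y \<in> A" "{u, v} = {c, y}" | y where "y \<in> B" "{u, v} = {d, y}"
      by blast
    then show "t \<in> ?R"
      by cases (auto simp: t doubleton_eq_iff abs_minus_commute)
  qed
  show "?R \<subseteq> ?L" by blast
qed

text \<open>
  The labeling itself. The hypothesis \<open>d \<in> A \<or> B = {}\<close> covers at once the double star whose second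
  centre is \<open>d\<close> and the star centred at \<open>c\<close>, in which \<open>d\<close> is arbitrary.
\<close>

lemma additively_graceful_broom:
  assumes finite: "finite A" "finite B"
    and distinct: "x \<noteq> c" "x \<notin> A \<union> B" "c \<notin> A \<union> B" "A \<inter> B = {}"
    and d: "d \<in> A \<or> B = {}"
    and verts: "verts S = {x, c} \<union> A \<union> B"
    and pos: "pos_edges S = (\<lambda>y. {c, y}) ` A \<union> (\<lambda>y. {d, y}) ` B"
    and neg: "neg_edges S = {{x, c}}"
  shows "additively_graceful S"
proof -
  define a b where "a = card A" and "b = card B"
  have "card B = card {2..<2 + b}"
    by (simp add: b_def)
  then obtain g where g: "bij_betw g B {2..<2 + b}"
    using finite_same_card_bij[of B "{2..<2 + b}"] finite(2) by blast
  obtain h where h: "bij_betw h A {b + 2..<b + 2 + a}" and hd: "d \<in> A \<Longrightarrow> h d = b + 2"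
    using ex_bij_betw_interval_fixing_min[OF finite(1)] a_def by metis
  define f where
    "f = (\<lambda>v. if v = x then 0 else if v = c then 1 else if v \<in> A then h v else g v)"
  have fxc: "f x = 0" "f c = 1"
    using distinct by (auto simp: f_def)
  have fA: "f v = h v" if "v \<in> A" for v
    using that distinct by (auto simp: f_def)
  have fB: "f v = g v" if "v \<in> B" for v
    using that distinct by (auto simp: f_def)
  have imA: "f ` A = {b + 2..<b + 2 + a}" and injA: "inj_on f A"
    using h fA by (auto simp: bij_betw_def inj_on_def)
  have imB: "f ` B = {2..<2 + b}" and injB: "inj_on f B"
    using g fB by (auto simp: bij_betw_def inj_on_def)

  have m: "card (pos_edges S) = a + b"
  proof -
    have "inj_on (\<lambda>y. {c, y}) A" "inj_on (\<lambda>y. {d, y}) B"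
      by (auto simp: inj_on_def doubleton_eq_iff)
    moreover have "(\<lambda>y. {c, y}) ` A \<inter> (\<lambda>y. {d, y}) ` B = {}"
      using d distinct by (auto simp: doubleton_eq_iff)
    ultimately show ?thesis
      using finite by (simp add: pos card_Un_disjoint card_image a_def b_def)
  qed
  have n: "card (neg_edges S) = 1"
    by (simp add: neg)

  have "f ` A \<inter> f ` B = {}"
    unfolding imA imB by auto
  then have "inj_on f (A \<union> B)"
    using injA injB by (auto simp: inj_on_Un)
  moreover have im: "f ` (A \<union> B) = {2..<2 + a + b}"
    unfolding image_Un imA imB by auto
  moreover have "inj_on f {x, c}" "f ` {x, c} \<inter> {2..<2 + a + b} = {}"
    using fxc by auto
  ultimately have "inj_on f ({x, c} \<union> (A \<union> B))"
    unfolding inj_on_Un[of f "{x, c}"] by blast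
  then have inj: "inj_on f (verts S)"
    by (simp add: verts Un_assoc)
  have range: "f ` verts S \<subseteq> {0..a + b + 1}"
    using im fxc by (auto simp: verts image_Un)

  have negsum: "{f u + f v | u v. {u, v} \<in> neg_edges S} = {1..1}"
  proof (intro equalityI subsetI)
    fix t :: nat assume "t \<in> {1..1}"
    then show "t \<in> {f u + f v | u v. {u, v} \<in> neg_edges S}"
      using fxc neg by (intro CollectI exI[of _ x] exI[of _ c]) auto
  qed (use fxc in \<open>auto simp: neg doubleton_eq_iff\<close>)

  have diffA: "(\<lambda>k. \<bar>int (f c) - int k\<bar>) ` f ` A = {int b + 1..int (a + b)}"
  proof -
    have "(\<lambda>k. \<bar>int (f c) - int k\<bar>) ` {b + 2..<b + 2 + a} = {int b + 1..int (a + b)}"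
    proof (intro equalityI subsetI)
      \<comment> \<open>\<open>c\<close> has label \<open>1\<close>, so the difference \<open>t\<close> occurs at the neighbour with label \<open>t + 1\<close>.\<close>
      fix t assume "t \<in> {int b + 1..int (a + b)}"
      then show "t \<in> (\<lambda>k. \<bar>int (f c) - int k\<bar>) ` {b + 2..<b + 2 + a}"
        using fxc by (intro image_eqI[of _ _ "nat (t + 1)"]) auto
    qed (use fxc in auto)
    then show ?thesis by (simp add: imA)
  qed
  have diffB: "(\<lambda>k. \<bar>int (f d) - int k\<bar>) ` f ` B = {1..int b}"
  proof (cases "B = {}")
    case True
    then show ?thesis by (simp add: b_def)
  next
    case False
    then have fd: "f d = b + 2"
      using d fA hd by auto
    have "(\<lambda>k. \<bar>int (f d) - int k\<bar>) ` {2..<2 + b} = {1..int b}"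
    proof (intro equalityI subsetI)
      \<comment> \<open>All labels in \<open>B\<close> are below \<open>b + 2\<close>, the label of \<open>d\<close>.\<close>
      fix t assume "t \<in> {1..int b}"
      then show "t \<in> (\<lambda>k. \<bar>int (f d) - int k\<bar>) ` {2..<2 + b}"
        using fd by (intro image_eqI[of _ _ "nat (int b + 2 - t)"]) auto
    qed (use fd in auto)
    then show ?thesis by (simp add: imB)
  qed
  have "{\<bar>int (f u) - int (f v)\<bar> | u v. {u, v} \<in> pos_edges S} = {1..int (a + b)}"
    unfolding pos edge_differences_two_stars diffA diffB by auto
  then have "additively_graceful_labeling S f"
    using inj range negsum by (simp add: additively_graceful_labeling_def Let_def m n)
  then show ?thesis
    unfolding additively_graceful_def by blast
qed

section \<open>Pendant edges of double stars\<close>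

lemma is_star_iff:
  "is_star (V, E) c r \<longleftrightarrow>
     finite V \<and> c \<in> V \<and> card (V - {c}) = r \<and> E = (\<lambda>y. {c, y}) ` (V - {c})"
  by (auto simp: is_star_def)

lemma degree_one_unique_edge:
  assumes "degree G v = 1" "e \<in> snd G" "v \<in> e" "e' \<in> snd G" "v \<in> e'"
  shows "e = e'"
proof -
  obtain w where "{e \<in> snd G. v \<in> e} = {w}"
    using assms(1) unfolding degree_def by (rule card_1_singletonE)
  moreover have "e \<in> {e \<in> snd G. v \<in> e}" "e' \<in> {e \<in> snd G. v \<in> e}"
    using assms(2-) by auto
  ultimately show ?thesis by simp
qed

text \<open>
  The end \<open>c\<close> of the pendant edge is always a centre of one of the stars. Exchanging the two
  stars leaves the graph unchanged, so two positions are typical. An edge of a star has the centre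
  \<open>d\<close> of the other star among the neighbours \<open>A\<close> of \<open>c\<close>. The edge between the centres can only
  be pendant if one centre \<open>x\<close> is the whole of its star, and then every other edge meets \<open>c\<close>.
\<close>

lemma double_star_pendant_edge_decomposition:
  assumes "double_star G" and pendant: "pendant_edge G e"
  obtains x c d A B where
    "finite A" "finite B" "x \<noteq> c" "x \<notin> A \<union> B" "c \<notin> A \<union> B" "A \<inter> B = {}"
    "d \<in> A \<or> B = {}" "fst G = {x, c} \<union> A \<union> B" "e = {x, c}"
    "snd G - {e} = (\<lambda>y. {c, y}) ` A \<union> (\<lambda>y. {d, y}) ` B"
proof -
  note decomposition = that
  obtain V1 E1 c1 r V2 E2 c2 s where
    star: "is_star (V1, E1) c1 r" "is_star (V2, E2) c2 s" and disj: "V1 \<inter> V2 = {}"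
    and G: "G = (V1 \<union> V2, E1 \<union> E2 \<union> {{c1, c2}})"
    using assms(1) unfolding double_star_def by blast
  have in_star: thesis
    if star1: "is_star (V, E) k i" and star2: "is_star (W, F) l j" and VW: "V \<inter> W = {}"
      and G': "G = (V \<union> W, E \<union> F \<union> {{k, l}})" and e: "e \<in> E"
    for V E k i W F l j
  proof -
    have V: "finite V" "k \<in> V" "E = (\<lambda>y. {k, y}) ` (V - {k})"
      and W: "finite W" "l \<in> W" "F = (\<lambda>y. {l, y}) ` (W - {l})"
      using star1 star2 by (auto simp: is_star_iff)
    obtain x where x: "x \<in> V" "x \<noteq> k" "e = {x, k}"
      using e V by blast
    have "snd G - {e} =
        (\<lambda>y. {k, y}) ` insert l (V - {k, x}) \<union> (\<lambda>y. {l, y}) ` (W - {l})" (is "_ = ?P")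
    proof -
      have "V - {k} = insert x (V - {k, x})"
        using x by blast
      then have "E = insert e ((\<lambda>y. {k, y}) ` (V - {k, x}))"
        unfolding V(3) x(3) by (metis image_insert insert_commute)
      then have "snd G = insert e ?P"
        unfolding G' W(3) by auto
      moreover have "e \<notin> ?P"
        using x VW V W by (auto simp: doubleton_eq_iff)
      ultimately show ?thesis by auto
    qed
    moreover have "fst G = {x, k} \<union> insert l (V - {k, x}) \<union> (W - {l})"
      unfolding G' using x(1) V(2) W(2) by auto
    moreover have "x \<notin> insert l (V - {k, x}) \<union> (W - {l})"
        "k \<notin> insert l (V - {k, x}) \<union> (W - {l})"
        "insert l (V - {k, x}) \<inter> (W - {l}) = {}"
      using x(1) V(2) W(2) VW by auto
    moreover have "finite (insert l (V - {k, x}))" "finite (W - {l})"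
      using V(1) W(1) by auto
    ultimately show thesis
      using x(2,3)
      by (intro decomposition[of "insert l (V - {k, x})" "W - {l}" x k l]) (assumption | blast)+
  qed
  have between_centres: thesis
    if star1: "is_star (V, E) k i" and star2: "is_star (W, F) l j" and VW: "V \<inter> W = {}"
      and G': "G = (V \<union> W, E \<union> F \<union> {{k, l}})" and e: "e = {k, l}" and deg: "degree G k = 1"
    for V E k i W F l j
  proof -
    have V: "finite V" "k \<in> V" "E = (\<lambda>y. {k, y}) ` (V - {k})"
      and W: "finite W" "l \<in> W" "F = (\<lambda>y. {l, y}) ` (W - {l})"
      using star1 star2 by (auto simp: is_star_iff)
    have "y = k" if "y \<in> V" for y
    proof (rule ccontr)
      assume "y \<noteq> k"
      then have "{k, y} = {k, l}"
        using that by (intro degree_one_unique_edge[OF deg]) (auto simp: G' V)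
      then show False
        using \<open>y \<noteq> k\<close> that VW W by (auto simp: doubleton_eq_iff)
    qed
    then have Vk: "V = {k}" using V(2) by blast
    have "{k, l} \<notin> (\<lambda>y. {l, y}) ` (W - {l})"
      using V(2) W(2) VW by (auto simp: doubleton_eq_iff)
    then have "snd G - {e} = (\<lambda>y. {l, y}) ` (W - {l})"
      unfolding G' V(3) W(3) Vk e by simp
    moreover have "fst G = {k, l} \<union> (W - {l})"
      unfolding G' Vk using W(2) by auto
    moreover have "k \<noteq> l" "k \<notin> W - {l}"
      using V(2) W(2) VW by auto
    ultimately show thesis
      using e W(1)
      by (intro decomposition[of "W - {l}" "{}" k l l]) simp_all
  qed
  have swap: "V2 \<inter> V1 = {}" "G = (V2 \<union> V1, E2 \<union> E1 \<union> {{c2, c1}})"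
    using disj by (auto simp: G insert_commute)
  have "e \<in> snd G" using pendant by (simp add: pendant_edge_def)
  then consider "e \<in> E1" | "e \<in> E2" | "e = {c1, c2}" by (auto simp: G)
  then show thesis
  proof cases
    case 1
    then show ?thesis by (rule in_star[OF star disj G])
  next
    case 2
    then show ?thesis by (rule in_star[OF star(2,1) swap])
  next
    case 3
    then consider "degree G c1 = 1" | "degree G c2 = 1"
      using pendant by (auto simp: pendant_edge_def)
    then show ?thesis
    proof cases
      case 1
      then show ?thesis by (rule between_centres[OF star disj G 3])
    next
      case 2
      have "e = {c2, c1}" using 3 by auto
      from between_centres[OF star(2,1) swap this 2] show ?thesis .
    qed
  qed
qed

section \<open>Signed double stars with one negative edge\<close>

theorem theorem3p2:
  fixes S :: "'a sgraph" and p m :: nat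
  assumes "signed_graph S p m 1"
    and "double_star (underlying S)"
    and "\<forall>e \<in> neg_edges S. pendant_edge (underlying S) e"
  shows "additively_graceful S"
proof -
  obtain e where neg: "neg_edges S = {e}"
    using assms(1) unfolding signed_graph_def by (auto simp: card_1_singleton_iff)
  have pos: "pos_edges S = snd (underlying S) - {e}"
    using assms(1) neg unfolding signed_graph_def underlying_def by auto
  have "pendant_edge (underlying S) e"
    using assms(3) neg by simp
  with assms(2) show ?thesis
  proof (rule double_star_pendant_edge_decomposition)
    fix x c d :: 'a and A B
    assume *: "finite A" "finite B" "x \<noteq> c" "x \<notin> A \<union> B" "c \<notin> A \<union> B" "A \<inter> B = {}"
      "d \<in> A \<or> B = {}"
      and G: "fst (underlying S) = {x, c} \<union> A \<union> B" "e = {x, c}"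
      "snd (underlying S) - {e} = (\<lambda>y. {c, y}) ` A \<union> (\<lambda>y. {d, y}) ` B"
    show ?thesis
    proof (rule additively_graceful_broom[OF *])
      show "verts S = {x, c} \<union> A \<union> B"
        using G(1) by (simp add: underlying_def)
      show "pos_edges S = (\<lambda>y. {c, y}) ` A \<union> (\<lambda>y. {d, y}) ` B"
        using pos G(3) by (rule trans)
      show "neg_edges S = {{x, c}}"
        using neg G(2) by simp
    qed
  qed
qed

end
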